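(* Let $\langle \mathbb{X}_n, T_n, \pi_{mn}\rangle_{\mathbb{N}}$ be a projective system of Polish spaces and $\langle \Phi_n, \eta_{nm}\rangle_{\mathbb{N}}$ a direct system of groups, with $\Phi_n$ acting measurably on $\mathbb{X}_n$, and suppose that the two systems are compatible. Let $\langle \mathbb{X}_{\mathbb{N}}, T_{\mathbb{N}}, \pi_n\rangle$ be the projective limit of the former and $\langle \Phi_{\mathbb{N}}, \eta_n\rangle$ the direct limit of the latter. Then the group $\Phi_{\mathbb{N}}$ acts on $(\mathbb{X}_{\mathbb{N}}, T_{\mathbb{N}})$ compatibly with respect to the $\pi_n$; that is, there is an action of $\Phi_{\mathbb{N}}$ on $\mathbb{X}_{\mathbb{N}}$ such that $$\pi_n\big((\eta_n\varphi_n)\,x\big) = \varphi_n\,\pi_n(x)\qquad\text{for all } n\ge 1,\ \varphi_n\in\Phi_n,\ x\in\mathbb{X}_{\mathbb{N}}.$$ Moreover, if $(\mu_n)_{n\ge 1}$ is a projective system of probability measures on $(\mathbb{X}_n,\sigma(T_n))$ such that $\mu_n$ is invariant with respect to $\Phi_n$ for every $n$, then the projective limit $\mu_{\mathbb{N}}$ of $(\mu_n)_{n\ge1}$ is invariant with respect to $\Phi_{\mathbb{N}}$ (for this action).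
   Context: All systems are indexed by the positive integers. A projective system of topological spaces $\langle \mathbb{X}_n,T_n,\pi_{mn}\rangle_{\mathbb{N}}$ consists of topological spaces $(\mathbb{X}_n,T_n)$, $n\ge1$, and continuous maps $\pi_{mn}:\mathbb{X}_m\to\mathbb{X}_n$ for $n\le m$, with $\pi_{nn}=\mathrm{id}$ and $\pi_{kn}=\pi_{mn}\circ\pi_{km}$ for $n\le m\le k$. Its projective limit is $\mathbb{X}_{\mathbb{N}}=\{(y_n)_{n\ge1}\in\prod_n\mathbb{X}_n : y_n=\pi_{mn}(y_m)\ \text{for all } n\le m\}$ with the coordinate maps $\pi_n:\mathbb{X}_{\mathbb{N}}\to\mathbb{X}_n$ and the smallest topology $T_{\mathbb{N}}$ making all $\pi_n$ continuous. A direct system of groups $\langle\Phi_n,\eta_{nm}\rangle_{\mathbb{N}}$ consists of groups $\Phi_n$ and homomorphisms $\eta_{nm}:\Phi_n\to\Phi_m$ for $n\le m$ with $\eta_{nn}=\mathrm{id}$ and $\eta_{nk}=\eta_{mk}\circ\eta_{nm}$ for $n\le m\le k$. Its direct limit is $\Phi_{\mathbb{N}}=\bigsqcup_n\Phi_n/\sim$, where $\varphi_n\sim\varphi_m$ iff $\eta_{nk}(\varphi_n)=\eta_{mk}(\varphi_m)$ for some $k\ge\max\{n,m\}$, with product $[\varphi_n][\varphi_m]=[\eta_{nk}(\varphi_n)\eta_{mk}(\varphi_m)]$ for some $k\geq\max\{n,m\}$, and homomorphisms $\eta_n(\varphi_n)=[\varphi_n]$. A group $\Phi$ acts measurably on a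 measurable space $(\mathbb{X},\mathcal{X})$ if it acts on $\mathbb{X}$ and $\varphi^{-1}A\in\mathcal{X}$ for all $\varphi\in\Phi$, $A\in\mathcal{X}$ (no measurable structure on $\Phi$ is required). A probability measure $\mu$ on $(\mathbb{X},\mathcal{X})$ is invariant with respect to such a $\Phi$ if $\mu(A)=\mu(\varphi^{-1}A)$ for all $\varphi\in\Phi$, $A\in\mathcal{X}$. The two systems are compatible if $\pi_{mn}^{-1}(\varphi_nA)=(\eta_{nm}\varphi_n)\pi_{mn}^{-1}(A)$ for all $n\le m$, $\varphi_n\in\Phi_n$, $A\in\sigma(T_n)$; equivalently, $\pi_{mn}((\eta_{nm}\varphi_n)x)=\varphi_n\pi_{mn}(x)$ for all $x\in\mathbb{X}_m$. A projective system of probability measures is a collection of probability measures $\mu_n$ on $(\mathbb{X}_n,\sigma(T_n))$ with $\mu_n=\pi_{mn}*\mu_m$ (push-forward: $f*\mu(B)=\mu(f^{-1}(B))$) for all $n<m$. Its projective limit is the unique probability measure $\mu_{\mathbb{N}}$ on $(\mathbb{X}_{\mathbb{N}},\sigma(T_{\mathbb{N}}))$ with $\pi_n*\mu_{\mathbb{N}}=\mu_n$ for all $n\ge1$; it is known to exist for Polish spaces (Bochner). *)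

theory Defs
  imports "HOL-Probability.Probability_Measure" "HOL-Algebra.Group_Action"
begin

definition polish_top :: "'a topology \<Rightarrow> bool" where
  "polish_top T \<longleftrightarrow> separable_space T \<and> completely_metrizable_space T"

definition borel_of_top :: "'a topology \<Rightarrow> 'a measure" where
  "borel_of_top T = sigma (topspace T) {U. openin T U}"

definition prob_measure_on :: "'a measure \<Rightarrow> 'a measure \<Rightarrow> bool" where
  "prob_measure_on N \<mu> \<longleftrightarrow> sets \<mu> = sets N \<and> prob_space \<mu>"

text \<open>
  The set \<open>g\<^sup>-\<^sup>1 A\<close> is the image of \<open>A\<close> under the action of the group element \<open>inv g\<close>. In
  \<^const>\<open>group_action\<close> the maps \<open>act g\<close>, for \<open>g\<close> in the carrier, are extensional bijections of
  the space.
\<close>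

definition measurable_action ::
    "('g, 'b) monoid_scheme \<Rightarrow> 'a measure \<Rightarrow> ('g \<Rightarrow> 'a \<Rightarrow> 'a) \<Rightarrow> bool" where
  "measurable_action G N act \<longleftrightarrow>
     group_action G (space N) act \<and>
     (\<forall>g\<in>carrier G. \<forall>A\<in>sets N. act (inv\<^bsub>G\<^esub> g) ` A \<in> sets N)"

definition invariant_measure ::
    "('g, 'b) monoid_scheme \<Rightarrow> ('g \<Rightarrow> 'a \<Rightarrow> 'a) \<Rightarrow> 'a measure \<Rightarrow> bool" where
  "invariant_measure G act \<mu> \<longleftrightarrow>
     (\<forall>g\<in>carrier G. \<forall>A\<in>sets \<mu>. emeasure \<mu> A = emeasure \<mu> (act (inv\<^bsub>G\<^esub> g) ` A))"

text \<open>
  Every system is indexed by the positive integers; values at the index \<open>0\<close> are irrelevant.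
  The map \<open>\<pi> m n\<close> goes from the \<open>m\<close>-th space to the \<open>n\<close>-th one. The spaces may have
  different underlying sets inside the common type \<open>'a\<close>.
\<close>

locale projective_system =
  fixes X :: "nat \<Rightarrow> 'a topology" and \<pi> :: "nat \<Rightarrow> nat \<Rightarrow> 'a \<Rightarrow> 'a"
  assumes continuous: "\<And>n m. \<lbrakk>1 \<le> n; n \<le> m\<rbrakk> \<Longrightarrow> continuous_map (X m) (X n) (\<pi> m n)"
    and identity: "\<And>n x. \<lbrakk>1 \<le> n; x \<in> topspace (X n)\<rbrakk> \<Longrightarrow> \<pi> n n x = x"
    and composition: "\<And>n m k x. \<lbrakk>1 \<le> n; n \<le> m; m \<le> k; x \<in> topspace (X k)\<rbrakk>
        \<Longrightarrow> \<pi> k n x = \<pi> m n (\<pi> k m x)"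

definition proj_lim_set :: "(nat \<Rightarrow> 'a topology) \<Rightarrow> (nat \<Rightarrow> nat \<Rightarrow> 'a \<Rightarrow> 'a) \<Rightarrow> (nat \<Rightarrow> 'a) set" where
  "proj_lim_set X \<pi> =
     {y \<in> (\<Pi>\<^sub>E n\<in>{1..}. topspace (X n)). \<forall>n m. 1 \<le> n \<and> n \<le> m \<longrightarrow> y n = \<pi> m n (y m)}"

text \<open>The coordinate map \<open>\<pi>\<^sub>n\<close> on the limit is \<open>\<lambda>y. y n\<close>.\<close>

definition proj_lim_top :: "(nat \<Rightarrow> 'a topology) \<Rightarrow> (nat \<Rightarrow> nat \<Rightarrow> 'a \<Rightarrow> 'a) \<Rightarrow> (nat \<Rightarrow> 'a) topology" where
  "proj_lim_top X \<pi> =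
     topology_generated_by {{y \<in> proj_lim_set X \<pi>. y n \<in> U} |n U. 1 \<le> n \<and> openin (X n) U}"

lemma topspace_proj_lim_top: "topspace (proj_lim_top X \<pi>) = proj_lim_set X \<pi>"
proof -
  have "proj_lim_set X \<pi> = {y \<in> proj_lim_set X \<pi>. y 1 \<in> topspace (X 1)}"
    by (auto simp: proj_lim_set_def PiE_def Pi_def)
  then have "proj_lim_set X \<pi> \<in> {{y \<in> proj_lim_set X \<pi>. y n \<in> U} |n U. 1 \<le> n \<and> openin (X n) U}"
    by blast
  then show ?thesis
    unfolding proj_lim_top_def topology_generated_by_topspace by blast
qed

text \<open>The map \<open>\<eta> n m\<close> goes from the \<open>n\<close>-th group to the \<open>m\<close>-th one.\<close>

locale direct_system =
  fixes G :: "nat \<Rightarrow> ('g, 'b) monoid_scheme" and \<eta> :: "nat \<Rightarrow> nat \<Rightarrow> 'g \<Rightarrow> 'g"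
  assumes groups: "\<And>n. 1 \<le> n \<Longrightarrow> group (G n)"
    and homomorphism: "\<And>n m. \<lbrakk>1 \<le> n; n \<le> m\<rbrakk> \<Longrightarrow> \<eta> n m \<in> hom (G n) (G m)"
    and identity: "\<And>n g. \<lbrakk>1 \<le> n; g \<in> carrier (G n)\<rbrakk> \<Longrightarrow> \<eta> n n g = g"
    and composition: "\<And>n m k g. \<lbrakk>1 \<le> n; n \<le> m; m \<le> k; g \<in> carrier (G n)\<rbrakk>
        \<Longrightarrow> \<eta> n k g = \<eta> m k (\<eta> n m g)"

text \<open>The disjoint union of the groups is rendered by pairs \<open>(n, g)\<close> with \<open>g\<close> in the \<open>n\<close>-th group.\<close>

definition dir_lim_pairs :: "(nat \<Rightarrow> ('g, 'b) monoid_scheme) \<Rightarrow> (nat \<times> 'g) set" where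
  "dir_lim_pairs G = (SIGMA n:{1..}. carrier (G n))"

definition dir_lim_rel ::
    "(nat \<Rightarrow> ('g, 'b) monoid_scheme) \<Rightarrow> (nat \<Rightarrow> nat \<Rightarrow> 'g \<Rightarrow> 'g) \<Rightarrow> ((nat \<times> 'g) \<times> (nat \<times> 'g)) set" where
  "dir_lim_rel G \<eta> =
     {((n, g), (m, h)) |n g m h. (n, g) \<in> dir_lim_pairs G \<and> (m, h) \<in> dir_lim_pairs G \<and>
        (\<exists>k\<ge>max n m. \<eta> n k g = \<eta> m k h)}"

definition dir_lim_map ::
    "(nat \<Rightarrow> ('g, 'b) monoid_scheme) \<Rightarrow> (nat \<Rightarrow> nat \<Rightarrow> 'g \<Rightarrow> 'g) \<Rightarrow> nat \<Rightarrow> 'g \<Rightarrow> (nat \<times> 'g) set" where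
  "dir_lim_map G \<eta> n g = dir_lim_rel G \<eta> `` {(n, g)}"

text \<open>
  In a direct system, the classes united in the product below are all equal: the class of
  \<open>\<eta> n k g \<cdot> \<eta> m k h\<close> depends neither on the representatives nor on \<open>k\<close>. In the same
  way the unit, here represented in the first group, is the class of the unit of any of the groups.
\<close>

definition dir_lim ::
    "(nat \<Rightarrow> ('g, 'b) monoid_scheme) \<Rightarrow> (nat \<Rightarrow> nat \<Rightarrow> 'g \<Rightarrow> 'g) \<Rightarrow> (nat \<times> 'g) set monoid" where
  "dir_lim G \<eta> =
     \<lparr>carrier = dir_lim_pairs G // dir_lim_rel G \<eta>,
      mult = (\<lambda>P Q. \<Union>{dir_lim_map G \<eta> k (\<eta> n k g \<otimes>\<^bsub>G k\<^esub> \<eta> m k h) |n g m h k.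
                       (n, g) \<in> P \<and> (m, h) \<in> Q \<and> max n m \<le> k}),
      one = dir_lim_map G \<eta> 1 \<one>\<^bsub>G 1\<^esub>\<rparr>"

definition compatible_systems ::
    "(nat \<Rightarrow> 'a topology) \<Rightarrow> (nat \<Rightarrow> nat \<Rightarrow> 'a \<Rightarrow> 'a) \<Rightarrow>
     (nat \<Rightarrow> ('g, 'b) monoid_scheme) \<Rightarrow> (nat \<Rightarrow> nat \<Rightarrow> 'g \<Rightarrow> 'g) \<Rightarrow>
     (nat \<Rightarrow> 'g \<Rightarrow> 'a \<Rightarrow> 'a) \<Rightarrow> bool" where
  "compatible_systems X \<pi> G \<eta> act \<longleftrightarrow>
     (\<forall>n m. 1 \<le> n \<and> n \<le> m \<longrightarrow>
       (\<forall>g\<in>carrier (G n). \<forall>A\<in>sets (borel_of_top (X n)).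
          \<pi> m n -` (act n g ` A) \<inter> topspace (X m) =
          act m (\<eta> n m g) ` (\<pi> m n -` A \<inter> topspace (X m))))"

definition projective_measures ::
    "(nat \<Rightarrow> 'a topology) \<Rightarrow> (nat \<Rightarrow> nat \<Rightarrow> 'a \<Rightarrow> 'a) \<Rightarrow> (nat \<Rightarrow> 'a measure) \<Rightarrow> bool" where
  "projective_measures X \<pi> \<mu> \<longleftrightarrow>
     (\<forall>n\<ge>1. prob_measure_on (borel_of_top (X n)) (\<mu> n)) \<and>
     (\<forall>n m. 1 \<le> n \<and> n < m \<longrightarrow> \<mu> n = distr (\<mu> m) (borel_of_top (X n)) (\<pi> m n))"

text \<open>
  A projective system of probability measures on Polish spaces has exactly one limit in the
  sense of the following predicate (Bochner).
\<close>

definition is_proj_lim_measure ::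
    "(nat \<Rightarrow> 'a topology) \<Rightarrow> (nat \<Rightarrow> nat \<Rightarrow> 'a \<Rightarrow> 'a) \<Rightarrow> (nat \<Rightarrow> 'a measure) \<Rightarrow>
     (nat \<Rightarrow> 'a) measure \<Rightarrow> bool" where
  "is_proj_lim_measure X \<pi> \<mu> \<nu> \<longleftrightarrow>
     prob_measure_on (borel_of_top (proj_lim_top X \<pi>)) \<nu> \<and>
     (\<forall>n\<ge>1. distr \<nu> (borel_of_top (X n)) (\<lambda>y. y n) = \<mu> n)"

end

(*
  A class of the direct limit represented by g at level n acts on the coordinates k >= n of a
  point by eta_nk(g), and compatibility makes these coordinates a thread. Since the X_n are second
  countable, the cylinders over Borel sets generate the Borel sets of the limit, and they form a
  pi-system because two cylinders can be moved to a common level. A group element maps cylinders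
  of a late level to cylinders of the same level, so it suffices to compare measures there, where
  invariance of the limit measure is invariance of mu_k.
*)

theory Submission
  imports Defs
begin

section \<open>Borel sets of topologies\<close>

text \<open>The maps \<open>act n g\<close> are only assumed measurable, so an element of the limit
  group need not act continuously on the limit space, and its measurability has to be tested on a
  generator. The preimage of a cylinder over an open set is in general only a cylinder over a Borel
  set. Admitting all Borel sets as bases makes the generator stable under these preimages, so that a
  single computation of preimages serves measurability and invariance alike. Second countability is
  what makes an open set of the limit a countable union of cylinders; an arbitrary union might leave
  the generated sigma-algebra. Compatibility speaks of sets, whereas the thread condition speaks of
  points; the passage from one to the other rests on singletons being closed in metrizable
  spaces.\<close>

lemma space_borel_of_top [simp]: "space (borel_of_top T) = topspace T"
  by (simp add: borel_of_top_def space_measure_of_conv)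

lemma sets_borel_of_top: "sets (borel_of_top T) = sigma_sets (topspace T) {U. openin T U}"
  by (auto simp: borel_of_top_def intro!: sets_measure_of dest: openin_subset)

lemma openin_imp_sets_borel_of_top: "openin T U \<Longrightarrow> U \<in> sets (borel_of_top T)"
  by (simp add: sets_borel_of_top)

lemma closedin_imp_sets_borel_of_top:
  assumes "closedin T C"
  shows "C \<in> sets (borel_of_top T)"
proof -
  have "space (borel_of_top T) - (topspace T - C) \<in> sets (borel_of_top T)"
    using assms by (intro sets.compl_sets openin_imp_sets_borel_of_top) auto
  then show ?thesis
    using closedin_subset[OF assms] by (simp add: double_diff)
qed

lemma continuous_map_imp_measurable:
  assumes "continuous_map S T f"
  shows "f \<in> measurable (borel_of_top S) (borel_of_top T)"
  unfolding borel_of_top_def[of T]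
proof (rule measurable_measure_of)
  show "{U. openin T U} \<subseteq> Pow (topspace T)"
    by (auto dest: openin_subset)
  show "f \<in> space (borel_of_top S) \<rightarrow> topspace T"
    using assms by (auto simp: continuous_map_def)
  fix U assume "U \<in> {U. openin T U}"
  then have "openin S {x \<in> topspace S. f x \<in> U}"
    using assms by (auto simp: continuous_map_def)
  then show "f -` U \<inter> space (borel_of_top S) \<in> sets (borel_of_top S)"
    by (auto simp: vimage_def Int_def conj_commute intro: openin_imp_sets_borel_of_top)
qed

text \<open>The balls of radius \<open>1 / real (Suc n)\<close> around the points of a countable
  dense set form a countable base.\<close>

lemma separable_metrizable_imp_second_countable:
  assumes "metrizable_space T" "separable_space T"
  shows "second_countable T"
proof -
  obtain M d where Md: "Metric_space M d" and T: "T = Metric_space.mtopology M d"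
    using assms(1) unfolding metrizable_space_def by blast
  interpret Metric_space M d by (rule Md)
  obtain C where C: "countable C" "C \<subseteq> M" "mtopology closure_of C = M"
    using assms(2) by (auto simp: separable_space_def T)
  let ?B = "(\<lambda>(c, n::nat). mball c (1 / real (Suc n))) ` (C \<times> UNIV)"
  have "\<exists>V\<in>?B. x \<in> V \<and> V \<subseteq> U" if U: "openin mtopology U" "x \<in> U" for U x
  proof -
    obtain r where r: "r > 0" "mball x r \<subseteq> U"
      using U by (auto simp: openin_mtopology)
    have x: "x \<in> M"
      using U openin_subset by fastforce
    \<comment> \<open>Half of \<open>r\<close>, because a point of the ball around \<open>c\<close>
      reaches \<open>x\<close> through \<open>c\<close>, and each of the two distances is below
      \<open>1 / real (Suc n)\<close>.\<close>
    obtain n where n: "1 / real (Suc n) < r / 2"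
      using nat_approx_posE[of "r / 2"] r by auto
    have "x \<in> mtopology closure_of C"
      using x C by simp
    then obtain c where c: "c \<in> C" "c \<in> mball x (1 / real (Suc n))"
      using centre_in_mball_iff x unfolding in_closure_of
      by (metis divide_pos_pos of_nat_0_less_iff openin_mball zero_less_Suc zero_less_one)
    have "mball c (1 / real (Suc n)) \<subseteq> mball x r"
    proof
      fix z assume "z \<in> mball c (1 / real (Suc n))"
      then show "z \<in> mball x r"
        using c n triangle[of x c z] by auto
    qed
    moreover have "x \<in> mball c (1 / real (Suc n))"
      using c by (simp add: commute)
    ultimately show ?thesis
      using c r by blast
  qed
  moreover have "countable ?B"
    using C by simp
  ultimately show ?thesis
    unfolding second_countable_def T by (intro exI[of _ ?B]) auto
qed

lemma polish_top_imp_metrizable: "polish_top T \<Longrightarrow> metrizable_space T"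
  by (simp add: polish_top_def completely_metrizable_imp_metrizable_space)

lemma polish_top_imp_second_countable: "polish_top T \<Longrightarrow> second_countable T"
  using polish_top_imp_metrizable separable_metrizable_imp_second_countable
  by (auto simp: polish_top_def)

section \<open>Group actions\<close>

text \<open>The definitions of measurable action and of invariance use images under inverse
  elements. Measurability and push-forwards use preimages, and this is the bridge.\<close>

lemma (in group_action) image_inv_eq_vimage:
  assumes g: "g \<in> carrier G" and A: "A \<subseteq> E"
  shows "\<phi> (inv g) ` A = \<phi> g -` A \<inter> E"
proof -
  interpret group G
    using group_hom by (rule group_hom.axioms(1))
  have g': "inv g \<in> carrier G"
    using g by simp
  show ?thesis
  proof (intro equalityI subsetI)
    fix x assume "x \<in> \<phi> (inv g) ` A"
    then obtain a where a: "a \<in> A" "x = \<phi> (inv g) a" by auto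
    then have "\<phi> (inv (inv g)) x = a"
      using orbit_sym_aux[OF g', of a x] A by auto
    then show "x \<in> \<phi> g -` A \<inter> E"
      using a A g g' element_image[OF g', of a x] by auto
  next
    fix x assume "x \<in> \<phi> g -` A \<inter> E"
    then show "x \<in> \<phi> (inv g) ` A"
      using orbit_sym_aux[OF g, of x "\<phi> g x"] by force
  qed
qed

text \<open>\<open>group_action\<close> demands a homomorphism into the group of extensional
  bijections. Bijectivity comes for free from the action laws, since the inverse element acts as the
  inverse map.\<close>

lemma group_actionI:
  assumes G: "group G"
    and closed: "\<And>g x. g \<in> carrier G \<Longrightarrow> x \<in> E \<Longrightarrow> \<phi> g x \<in> E"
    and ext: "\<And>g. g \<in> carrier G \<Longrightarrow> \<phi> g \<in> extensional E"
    and one: "\<And>x. x \<in> E \<Longrightarrow> \<phi> \<one>\<^bsub>G\<^esub> x = x"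
    and mult: "\<And>g h x. g \<in> carrier G \<Longrightarrow> h \<in> carrier G \<Longrightarrow> x \<in> E \<Longrightarrow>
      \<phi> (g \<otimes>\<^bsub>G\<^esub> h) x = \<phi> g (\<phi> h x)"
  shows "group_action G E \<phi>"
proof -
  interpret group G by (rule G)
  have bij: "\<phi> g \<in> Bij E" if g: "g \<in> carrier G" for g
  proof -
    have "\<phi> (inv\<^bsub>G\<^esub> g) (\<phi> g x) = x" "\<phi> g (\<phi> (inv\<^bsub>G\<^esub> g) x) = x" if "x \<in> E" for x
      using mult[of "inv\<^bsub>G\<^esub> g" g x] mult[of g "inv\<^bsub>G\<^esub> g" x] g that one by simp_all
    then have "bij_betw (\<phi> g) E E"
      using g closed by (intro bij_betw_byWitness[where f' = "\<phi> (inv\<^bsub>G\<^esub> g)"]) auto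
    then show ?thesis
      using ext[OF g] by (simp add: Bij_def)
  qed
  have "\<phi> (g \<otimes>\<^bsub>G\<^esub> h) = compose E (\<phi> g) (\<phi> h)"
    if "g \<in> carrier G" "h \<in> carrier G" for g h
    using that mult by (intro extensionalityI[of _ E] ext) (auto simp: compose_def)
  then have "\<phi> \<in> hom G (BijGroup E)"
    using bij by (auto simp: hom_def BijGroup_def)
  then show ?thesis
    by (simp add: group_action_def group_hom_def group_hom_axioms_def G group_BijGroup)
qed

lemma measurable_action_imp_measurable:
  assumes "measurable_action G N act" "g \<in> carrier G"
  shows "act g \<in> measurable N N"
proof -
  interpret group_action G "space N" act
    using assms by (simp add: measurable_action_def)
  show ?thesis
  proof (rule measurableI)
    show "act g x \<in> space N" if "x \<in> space N" for x
      using element_image that assms(2) by blast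
    show "act g -` A \<inter> space N \<in> sets N" if "A \<in> sets N" for A
      using image_inv_eq_vimage[OF assms(2) sets.sets_into_space[OF that], symmetric] that assms
      by (simp add: measurable_action_def)
  qed
qed

lemma measurable_actionI:
  assumes "group_action G (space N) act"
    and "\<And>g. g \<in> carrier G \<Longrightarrow> act g \<in> measurable N N"
  shows "measurable_action G N act"
proof -
  interpret group_action G "space N" act by (rule assms(1))
  have "act (inv\<^bsub>G\<^esub> g) ` A \<in> sets N" if "g \<in> carrier G" "A \<in> sets N" for g A
    using image_inv_eq_vimage[OF that(1), of A] sets.sets_into_space[OF that(2)]
      measurable_sets[OF assms(2)] that by auto
  then show ?thesis
    by (simp add: measurable_action_def assms(1))
qed

lemma (in group_action) invariant_measure_iff:
  assumes "space \<mu> = E"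
  shows "invariant_measure G \<phi> \<mu> \<longleftrightarrow>
    (\<forall>g\<in>carrier G. \<forall>A\<in>sets \<mu>. emeasure \<mu> A = emeasure \<mu> (\<phi> g -` A \<inter> E))"
proof -
  have "\<phi> (inv g) ` A = \<phi> g -` A \<inter> E" if "g \<in> carrier G" "A \<in> sets \<mu>" for g A
    using image_inv_eq_vimage[OF that(1)] sets.sets_into_space[OF that(2)] assms by simp
  then show ?thesis
    unfolding invariant_measure_def by (metis (no_types, lifting))
qed

section \<open>Direct limits of groups\<close>

context direct_system
begin

lemma map_closed: "\<lbrakk>1 \<le> n; n \<le> m; g \<in> carrier (G n)\<rbrakk> \<Longrightarrow> \<eta> n m g \<in> carrier (G m)"
  using homomorphism[of n m] by (rule hom_in_carrier) auto

lemma map_mult: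
  "\<lbrakk>1 \<le> n; n \<le> m; g \<in> carrier (G n); h \<in> carrier (G n)\<rbrakk> \<Longrightarrow>
    \<eta> n m (g \<otimes>\<^bsub>G n\<^esub> h) = \<eta> n m g \<otimes>\<^bsub>G m\<^esub> \<eta> n m h"
  by (rule hom_mult[OF homomorphism])

lemma map_one: "\<lbrakk>1 \<le> n; n \<le> m\<rbrakk> \<Longrightarrow> \<eta> n m \<one>\<^bsub>G n\<^esub> = \<one>\<^bsub>G m\<^esub>"
  using hom_one[OF homomorphism] groups by simp

lemma rel_iff:
  "((n, g), (m, h)) \<in> dir_lim_rel G \<eta> \<longleftrightarrow>
    1 \<le> n \<and> 1 \<le> m \<and> g \<in> carrier (G n) \<and> h \<in> carrier (G m) \<and>
    (\<exists>k\<ge>max n m. \<eta> n k g = \<eta> m k h)"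
  by (auto simp: dir_lim_rel_def dir_lim_pairs_def)

text \<open>Applying \<open>\<eta> k l\<close> to an equality at level \<open>k\<close> carries it
  to level \<open>l\<close>. Finitely many identifications can therefore be read at one common
  level.\<close>

lemma eq_later:
  assumes "1 \<le> n" "1 \<le> m" "g \<in> carrier (G n)" "h \<in> carrier (G m)"
    and "max n m \<le> k" "\<eta> n k g = \<eta> m k h" "k \<le> l"
  shows "\<eta> n l g = \<eta> m l h"
  using composition[of n k l g] composition[of m k l h] assms by simp

lemma equiv_rel: "equiv (dir_lim_pairs G) (dir_lim_rel G \<eta>)"
proof (rule equivI)
  show "dir_lim_rel G \<eta> \<subseteq> dir_lim_pairs G \<times> dir_lim_pairs G"
    by (auto simp: dir_lim_rel_def)
  show "refl_on (dir_lim_pairs G) (dir_lim_rel G \<eta>)"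
    by (auto simp: refl_on_def rel_iff dir_lim_pairs_def)
  show "sym (dir_lim_rel G \<eta>)"
    by (auto simp: sym_def rel_iff)
  show "trans (dir_lim_rel G \<eta>)"
  proof (rule transI, clarify)
    fix n1 g1 n2 g2 n3 g3
    assume "((n1, g1), (n2, g2)) \<in> dir_lim_rel G \<eta>" "((n2, g2), (n3, g3)) \<in> dir_lim_rel G \<eta>"
    then obtain k l where *: "1 \<le> n1" "1 \<le> n2" "1 \<le> n3"
      "g1 \<in> carrier (G n1)" "g2 \<in> carrier (G n2)" "g3 \<in> carrier (G n3)"
      and k: "max n1 n2 \<le> k" "\<eta> n1 k g1 = \<eta> n2 k g2"
      and l: "max n2 n3 \<le> l" "\<eta> n2 l g2 = \<eta> n3 l g3"
      unfolding rel_iff by blast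
    have "\<eta> n1 (max k l) g1 = \<eta> n3 (max k l) g3"
      using eq_later[of n1 n2 g1 g2 k "max k l"] eq_later[of n2 n3 g2 g3 l "max k l"] * k l
      by simp
    moreover have "max n1 n3 \<le> max k l"
      using k l by auto
    ultimately show "((n1, g1), (n3, g3)) \<in> dir_lim_rel G \<eta>"
      using * by (auto simp only: rel_iff)
  qed
qed

lemma dir_lim_map_eq_iff:
  assumes "1 \<le> n" "g \<in> carrier (G n)" "1 \<le> m" "h \<in> carrier (G m)"
  shows "dir_lim_map G \<eta> n g = dir_lim_map G \<eta> m h \<longleftrightarrow> (\<exists>k\<ge>max n m. \<eta> n k g = \<eta> m k h)"
  unfolding dir_lim_map_def
  by (subst eq_equiv_class_iff[OF equiv_rel]) (use assms in \<open>auto simp: rel_iff dir_lim_pairs_def\<close>)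

lemma dir_lim_map_shift:
  assumes "1 \<le> n" "n \<le> m" "g \<in> carrier (G n)"
  shows "dir_lim_map G \<eta> m (\<eta> n m g) = dir_lim_map G \<eta> n g"
proof -
  have "\<eta> m m (\<eta> n m g) = \<eta> n m g"
    using identity[of m "\<eta> n m g"] map_closed assms by simp
  then show ?thesis
    using assms map_closed by (subst dir_lim_map_eq_iff) auto
qed

lemma mem_dir_lim_map_iff:
  assumes "1 \<le> n" "g \<in> carrier (G n)"
  shows "(m, h) \<in> dir_lim_map G \<eta> n g \<longleftrightarrow>
    1 \<le> m \<and> h \<in> carrier (G m) \<and> (\<exists>k\<ge>max n m. \<eta> n k g = \<eta> m k h)"
  using assms by (auto simp: dir_lim_map_def rel_iff)

lemma dir_lim_map_closed:
  "\<lbrakk>1 \<le> n; g \<in> carrier (G n)\<rbrakk> \<Longrightarrow> dir_lim_map G \<eta> n g \<in> carrier (dir_lim G \<eta>)"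
  by (auto simp: dir_lim_def dir_lim_map_def dir_lim_pairs_def intro!: quotientI)

text \<open>Having representatives at all levels from some \<open>n\<close> on, rather than at one
  level, is what lets several classes (or a class and a cylinder) be brought to the maximum of their
  thresholds.\<close>

lemma dir_lim_carrier_levels:
  assumes "P \<in> carrier (dir_lim G \<eta>)"
  obtains n where "1 \<le> n" "\<And>k. n \<le> k \<Longrightarrow> \<exists>g\<in>carrier (G k). P = dir_lim_map G \<eta> k g"
proof -
  obtain n g where "1 \<le> n" "g \<in> carrier (G n)" "P = dir_lim_map G \<eta> n g"
    using assms by (auto simp: dir_lim_def dir_lim_map_def dir_lim_pairs_def elim!: quotientE)
  then show ?thesis
    using that[of n] map_closed dir_lim_map_shift by metis
qed

text \<open>The product is defined as a union over all representatives and all admissible levels.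
  All the classes in that union coincide, so it collapses to the one computed in
  \<open>G k\<close>.\<close>

lemma dir_lim_mult:
  assumes k: "1 \<le> k" and g: "g \<in> carrier (G k)" and h: "h \<in> carrier (G k)"
  shows "dir_lim_map G \<eta> k g \<otimes>\<^bsub>dir_lim G \<eta>\<^esub> dir_lim_map G \<eta> k h =
    dir_lim_map G \<eta> k (g \<otimes>\<^bsub>G k\<^esub> h)"
proof -
  let ?P = "dir_lim_map G \<eta> k g" and ?Q = "dir_lim_map G \<eta> k h"
  have closed: "x \<otimes>\<^bsub>G n\<^esub> y \<in> carrier (G n)"
    if "1 \<le> n" "x \<in> carrier (G n)" "y \<in> carrier (G n)" for n x y
    using groups[OF that(1)] that by (simp add: group.subgroup_self subgroup.m_closed)
  have "dir_lim_map G \<eta> l (\<eta> n l x \<otimes>\<^bsub>G l\<^esub> \<eta> m l y) = dir_lim_map G \<eta> k (g \<otimes>\<^bsub>G k\<^esub> h)"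
    if xy: "(n, x) \<in> ?P" "(m, y) \<in> ?Q" and l: "max n m \<le> l" for n x m y l
  proof -
    obtain i j where n: "1 \<le> n" "x \<in> carrier (G n)" and m: "1 \<le> m" "y \<in> carrier (G m)"
      and i: "max k n \<le> i" "\<eta> k i g = \<eta> n i x" and j: "max k m \<le> j" "\<eta> k j h = \<eta> m j y"
      using xy by (auto simp only: mem_dir_lim_map_iff[OF k g] mem_dir_lim_map_iff[OF k h])
    \<comment> \<open>The representatives \<open>x\<close> and \<open>y\<close> are known to agree
      with \<open>g\<close> and \<open>h\<close> from the levels \<open>i\<close> and
      \<open>j\<close> on. \<open>L\<close> is beyond both, and beyond the level \<open>l\<close> at
      which the product is formed.\<close>
    define L where "L = max l (max i j)"
    have L: "n \<le> l" "m \<le> l" "l \<le> L" "k \<le> L" "i \<le> L" "j \<le> L" "1 \<le> l"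
      using i j l n by (auto simp: L_def)
    have "\<eta> l L (\<eta> n l x \<otimes>\<^bsub>G l\<^esub> \<eta> m l y) = \<eta> n L x \<otimes>\<^bsub>G L\<^esub> \<eta> m L y"
      using n m L by (simp add: map_mult map_closed composition[of n l L] composition[of m l L])
    also have "\<dots> = \<eta> k L g \<otimes>\<^bsub>G L\<^esub> \<eta> k L h"
      using eq_later[OF k n(1) g n(2) i L(5)] eq_later[OF k m(1) h m(2) j L(6)] by simp
    also have "\<dots> = \<eta> k L (g \<otimes>\<^bsub>G k\<^esub> h)"
      using k g h L by (simp add: map_mult)
    finally show ?thesis
      using L k g h n m by (subst dir_lim_map_eq_iff) (auto intro!: closed map_closed)
  qed
  \<comment> \<open>The given representatives at level \<open>k\<close> contribute a member, so the
    family of classes is nonempty and hence exactly a singleton.\<close>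
  moreover have "(k, g) \<in> ?P" "(k, h) \<in> ?Q" "\<eta> k k g = g" "\<eta> k k h = h"
    using assms identity by (auto simp: mem_dir_lim_map_iff)
  ultimately have "{dir_lim_map G \<eta> l (\<eta> n l x \<otimes>\<^bsub>G l\<^esub> \<eta> m l y) |n x m y l.
      (n, x) \<in> ?P \<and> (m, y) \<in> ?Q \<and> max n m \<le> l} = {dir_lim_map G \<eta> k (g \<otimes>\<^bsub>G k\<^esub> h)}"
    by blast
  then show ?thesis
    by (simp add: dir_lim_def)
qed

lemma dir_lim_one: "1 \<le> k \<Longrightarrow> \<one>\<^bsub>dir_lim G \<eta>\<^esub> = dir_lim_map G \<eta> k \<one>\<^bsub>G k\<^esub>"
  using dir_lim_map_shift[of 1 k "\<one>\<^bsub>G 1\<^esub>"] map_one[of 1 k] groups[of 1]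
  by (simp add: dir_lim_def group.is_monoid)

lemma dir_lim_carrier2E:
  assumes "P \<in> carrier (dir_lim G \<eta>)" "Q \<in> carrier (dir_lim G \<eta>)"
  obtains k g h where "1 \<le> k" "g \<in> carrier (G k)" "h \<in> carrier (G k)"
    "P = dir_lim_map G \<eta> k g" "Q = dir_lim_map G \<eta> k h"
proof -
  obtain n where n: "1 \<le> n" "\<And>k. n \<le> k \<Longrightarrow> \<exists>g\<in>carrier (G k). P = dir_lim_map G \<eta> k g"
    using dir_lim_carrier_levels[OF assms(1)] by blast
  obtain m where m: "1 \<le> m" "\<And>k. m \<le> k \<Longrightarrow> \<exists>g\<in>carrier (G k). Q = dir_lim_map G \<eta> k g"
    using dir_lim_carrier_levels[OF assms(2)] by blast
  show ?thesis
    using that[of "max n m"] n(1) m(2)[of "max n m"] n(2)[of "max n m"]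
    by (meson le_trans max.cobounded1 max.cobounded2)
qed

text \<open>Finitely many classes have representatives in one group, where their products are
  computed by \<open>dir_lim_mult\<close>. Each axiom is thus inherited from a single level.\<close>

lemma group_dir_lim: "group (dir_lim G \<eta>)"
proof (rule groupI)
  fix P Q assume PQ: "P \<in> carrier (dir_lim G \<eta>)" "Q \<in> carrier (dir_lim G \<eta>)"
  obtain k g h where k: "1 \<le> k" "g \<in> carrier (G k)" "h \<in> carrier (G k)"
    "P = dir_lim_map G \<eta> k g" "Q = dir_lim_map G \<eta> k h"
    by (rule dir_lim_carrier2E[OF PQ])
  interpret group "G k" using groups k by simp
  show "P \<otimes>\<^bsub>dir_lim G \<eta>\<^esub> Q \<in> carrier (dir_lim G \<eta>)"
    using k by (simp add: dir_lim_mult dir_lim_map_closed)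
  fix R assume R: "R \<in> carrier (dir_lim G \<eta>)"
  obtain n where n: "1 \<le> n" "\<And>k. n \<le> k \<Longrightarrow> \<exists>g\<in>carrier (G k). R = dir_lim_map G \<eta> k g"
    using dir_lim_carrier_levels[OF R] by blast
  define K where "K = max n k"
  have K: "1 \<le> K" "k \<le> K" "n \<le> K" using n by (auto simp: K_def)
  interpret K: group "G K" using groups K by simp
  obtain r where r: "r \<in> carrier (G K)" "R = dir_lim_map G \<eta> K r"
    using n K by blast
  have PQ: "P = dir_lim_map G \<eta> K (\<eta> k K g)" "Q = dir_lim_map G \<eta> K (\<eta> k K h)"
    using dir_lim_map_shift[of k K] k K by metis+
  show "P \<otimes>\<^bsub>dir_lim G \<eta>\<^esub> Q \<otimes>\<^bsub>dir_lim G \<eta>\<^esub> R = P \<otimes>\<^bsub>dir_lim G \<eta>\<^esub> (Q \<otimes>\<^bsub>dir_lim G \<eta>\<^esub> R)"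
    unfolding PQ using K r k map_closed[of k K] by (simp add: dir_lim_mult K.m_assoc)
next
  show "\<one>\<^bsub>dir_lim G \<eta>\<^esub> \<in> carrier (dir_lim G \<eta>)"
    using groups[of 1] by (simp add: dir_lim_one[of 1] dir_lim_map_closed group.is_monoid)
next
  fix P assume P: "P \<in> carrier (dir_lim G \<eta>)"
  obtain k g where k: "1 \<le> k" "g \<in> carrier (G k)" "P = dir_lim_map G \<eta> k g"
    by (rule dir_lim_carrier2E[OF P P])
  interpret group "G k" using groups k by simp
  show "\<one>\<^bsub>dir_lim G \<eta>\<^esub> \<otimes>\<^bsub>dir_lim G \<eta>\<^esub> P = P"
    using k by (simp add: dir_lim_one[of k] dir_lim_mult)
  show "\<exists>Q\<in>carrier (dir_lim G \<eta>). Q \<otimes>\<^bsub>dir_lim G \<eta>\<^esub> P = \<one>\<^bsub>dir_lim G \<eta>\<^esub>"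
    using k by (intro bexI[of _ "dir_lim_map G \<eta> k (inv\<^bsub>G k\<^esub> g)"])
      (auto simp: dir_lim_one[of k] dir_lim_mult dir_lim_map_closed)
qed

end

section \<open>Cylinder sets in projective limits\<close>

definition cylinder ::
    "(nat \<Rightarrow> 'a topology) \<Rightarrow> (nat \<Rightarrow> nat \<Rightarrow> 'a \<Rightarrow> 'a) \<Rightarrow> nat \<Rightarrow> 'a set \<Rightarrow> (nat \<Rightarrow> 'a) set" where
  "cylinder X \<pi> n A = {y \<in> proj_lim_set X \<pi>. y n \<in> A}"

definition borel_cylinders ::
    "(nat \<Rightarrow> 'a topology) \<Rightarrow> (nat \<Rightarrow> nat \<Rightarrow> 'a \<Rightarrow> 'a) \<Rightarrow> (nat \<Rightarrow> 'a) set set" where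
  "borel_cylinders X \<pi> = {cylinder X \<pi> n A |n A. 1 \<le> n \<and> A \<in> sets (borel_of_top (X n))}"

lemma borel_cylinders_subset: "borel_cylinders X \<pi> \<subseteq> Pow (proj_lim_set X \<pi>)"
  by (auto simp: borel_cylinders_def cylinder_def)

lemma proj_lim_set_coord: "\<lbrakk>y \<in> proj_lim_set X \<pi>; 1 \<le> n\<rbrakk> \<Longrightarrow> y n \<in> topspace (X n)"
  by (auto simp: proj_lim_set_def)

lemma proj_lim_set_proj: "\<lbrakk>y \<in> proj_lim_set X \<pi>; 1 \<le> n; n \<le> m\<rbrakk> \<Longrightarrow> \<pi> m n (y m) = y n"
  by (simp add: proj_lim_set_def)

text \<open>An early coordinate of a thread is the projection of a late one, so late coordinates
  decide equality. The value at index 0 is fixed by extensionality.\<close>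

lemma proj_lim_set_eqI:
  assumes "y \<in> proj_lim_set X \<pi>" "z \<in> proj_lim_set X \<pi>" "\<And>k. N \<le> k \<Longrightarrow> y k = z k"
  shows "y = z"
proof (rule extensionalityI[of _ "{1..}"])
  show "y \<in> extensional {1..}" "z \<in> extensional {1..}"
    using assms by (auto simp: proj_lim_set_def PiE_def)
  fix k :: nat assume "k \<in> {1..}"
  then show "y k = z k"
    using proj_lim_set_proj[OF assms(1), of k "max N k"] proj_lim_set_proj[OF assms(2), of k "max N k"]
      assms(3)[of "max N k"] by simp
qed

lemma openin_cylinder:
  "\<lbrakk>1 \<le> n; openin (X n) U\<rbrakk> \<Longrightarrow> openin (proj_lim_top X \<pi>) (cylinder X \<pi> n U)"
  unfolding proj_lim_top_def cylinder_def by (intro topology_generated_by_Basis) blast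

lemma continuous_map_coord:
  assumes "1 \<le> n"
  shows "continuous_map (proj_lim_top X \<pi>) (X n) (\<lambda>y. y n)"
  using openin_cylinder[OF assms, of X _ \<pi>] assms
  by (auto simp: continuous_map_def topspace_proj_lim_top cylinder_def proj_lim_set_coord)

context projective_system
begin

lemma cylinder_lift:
  assumes "1 \<le> n" "n \<le> m"
  shows "cylinder X \<pi> n A = cylinder X \<pi> m (\<pi> m n -` A \<inter> topspace (X m))"
  using assms by (auto simp: cylinder_def proj_lim_set_proj proj_lim_set_coord)

text \<open>Preimages under the continuous map \<open>\<pi> m n\<close> are Borel, so a cylinder can
  be rewritten at every later level. The threshold form serves to align several cylinders at one
  level.\<close>

lemma borel_cylinders_level:
  assumes "C \<in> borel_cylinders X \<pi>"
  obtains n where "1 \<le> n"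
    "\<And>m. n \<le> m \<Longrightarrow> \<exists>A\<in>sets (borel_of_top (X m)). C = cylinder X \<pi> m A"
proof -
  obtain n A where n: "1 \<le> n" "A \<in> sets (borel_of_top (X n))" "C = cylinder X \<pi> n A"
    using assms by (auto simp: borel_cylinders_def)
  have "\<exists>A\<in>sets (borel_of_top (X m)). C = cylinder X \<pi> m A" if "n \<le> m" for m
    using measurable_sets[OF continuous_map_imp_measurable[OF continuous[OF n(1) that]] n(2)]
      cylinder_lift[OF n(1) that, of A] n(3) by auto
  then show ?thesis
    using that n(1) by blast
qed

lemma Int_stable_borel_cylinders: "Int_stable (borel_cylinders X \<pi>)"
proof (rule Int_stableI)
  fix C D assume C: "C \<in> borel_cylinders X \<pi>" and D: "D \<in> borel_cylinders X \<pi>"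
  obtain n where n: "1 \<le> n"
    "\<And>m. n \<le> m \<Longrightarrow> \<exists>A\<in>sets (borel_of_top (X m)). C = cylinder X \<pi> m A"
    using borel_cylinders_level[OF C] by blast
  obtain m where m: "1 \<le> m"
    "\<And>k. m \<le> k \<Longrightarrow> \<exists>A\<in>sets (borel_of_top (X k)). D = cylinder X \<pi> k A"
    using borel_cylinders_level[OF D] by blast
  obtain A B where AB: "A \<in> sets (borel_of_top (X (max n m)))" "C = cylinder X \<pi> (max n m) A"
    "B \<in> sets (borel_of_top (X (max n m)))" "D = cylinder X \<pi> (max n m) B"
    using n(2)[of "max n m"] m(2)[of "max n m"] by auto
  then have "C \<inter> D = cylinder X \<pi> (max n m) (A \<inter> B)"
    by (auto simp: cylinder_def)
  moreover have "A \<inter> B \<in> sets (borel_of_top (X (max n m)))" "1 \<le> max n m"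
    using AB n by auto
  ultimately show "C \<inter> D \<in> borel_cylinders X \<pi>"
    unfolding borel_cylinders_def by blast
qed

text \<open>The cylinders over open sets are introduced as a subbase. They are in fact a base,
  because two of them can be lifted to level \<open>max n m\<close> and intersected there.\<close>

lemma openin_proj_lim_top_cylinder:
  assumes "openin (proj_lim_top X \<pi>) U" "y \<in> U"
  obtains n V where "1 \<le> n" "openin (X n) V" "y \<in> cylinder X \<pi> n V" "cylinder X \<pi> n V \<subseteq> U"
proof -
  have "generate_topology_on {{y \<in> proj_lim_set X \<pi>. y n \<in> U} |n U. 1 \<le> n \<and> openin (X n) U} U"
    using assms(1) unfolding proj_lim_top_def by (rule openin_topology_generated_by)
  then have "\<exists>n V. 1 \<le> n \<and> openin (X n) V \<and> y \<in> cylinder X \<pi> n V \<and> cylinder X \<pi> n V \<subseteq> U"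
    using assms(2)
  proof (induction rule: generate_topology_on.induct)
    case Empty
    then show ?case by simp
  next
    case (Int a b)
    then obtain n V m W where
      n: "1 \<le> n" "openin (X n) V" "y \<in> cylinder X \<pi> n V" "cylinder X \<pi> n V \<subseteq> a" and
      m: "1 \<le> m" "openin (X m) W" "y \<in> cylinder X \<pi> m W" "cylinder X \<pi> m W \<subseteq> b"
      by blast
    define k where "k = max n m"
    define V' where "V' = \<pi> k n -` V \<inter> topspace (X k)"
    define W' where "W' = \<pi> k m -` W \<inter> topspace (X k)"
    have "cylinder X \<pi> n V = cylinder X \<pi> k V'" "cylinder X \<pi> m W = cylinder X \<pi> k W'"
      unfolding V'_def W'_def using n m by (auto intro!: cylinder_lift simp: k_def)
    moreover have "cylinder X \<pi> k (V' \<inter> W') = cylinder X \<pi> k V' \<inter> cylinder X \<pi> k W'"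
      by (auto simp: cylinder_def)
    moreover have "openin (X k) V'" "openin (X k) W'"
      unfolding V'_def W'_def
      using n m continuous[of n k] continuous[of m k] by (auto simp: k_def continuous_map_alt)
    moreover have "1 \<le> k"
      using n by (simp add: k_def)
    ultimately have "1 \<le> k \<and> openin (X k) (V' \<inter> W') \<and>
        y \<in> cylinder X \<pi> k (V' \<inter> W') \<and> cylinder X \<pi> k (V' \<inter> W') \<subseteq> a \<inter> b"
      using n(3,4) m(3,4) by blast
    then show ?case
      by blast
  next
    case (UN K)
    then obtain k where "k \<in> K" "y \<in> k"
      by blast
    with UN.IH[of k] show ?case
      by (meson Union_upper subset_trans)
  next
    case (Basis s)
    then show ?case by (auto simp: cylinder_def)
  qed
  then show ?thesis
    using that by blast
qed

lemma sets_borel_proj_lim_top: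
  assumes "\<And>n. 1 \<le> n \<Longrightarrow> second_countable (X n)"
  shows "sets (borel_of_top (proj_lim_top X \<pi>)) =
    sigma_sets (proj_lim_set X \<pi>) (borel_cylinders X \<pi>)"
proof (intro equalityI)
  have "\<forall>n\<in>{1..}. \<exists>B. countable B \<and> (\<forall>V\<in>B. openin (X n) V) \<and>
      (\<forall>U x. openin (X n) U \<and> x \<in> U \<longrightarrow> (\<exists>V\<in>B. x \<in> V \<and> V \<subseteq> U))"
    using assms unfolding second_countable_def by simp
  then obtain B where "\<forall>n\<in>{1..}. countable (B n) \<and> (\<forall>V\<in>B n. openin (X n) V) \<and>
      (\<forall>U x. openin (X n) U \<and> x \<in> U \<longrightarrow> (\<exists>V\<in>B n. x \<in> V \<and> V \<subseteq> U))"
    by (rule bchoice[THEN exE])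
  then have B: "1 \<le> n \<Longrightarrow> countable (B n)"
    "1 \<le> n \<Longrightarrow> V \<in> B n \<Longrightarrow> openin (X n) V"
    "1 \<le> n \<Longrightarrow> openin (X n) U \<Longrightarrow> x \<in> U \<Longrightarrow> \<exists>V\<in>B n. x \<in> V \<and> V \<subseteq> U" for n V U x
    by auto
  have "U \<in> sigma_sets (proj_lim_set X \<pi>) (borel_cylinders X \<pi>)"
    if U: "openin (proj_lim_top X \<pi>) U" for U
  proof -
    \<comment> \<open>Only cylinders over members of the chosen countable bases are used. There are
      countably many levels and countably many base sets per level, so the union over
      \<open>?C\<close> is countable.\<close>
    let ?C = "{C \<in> (\<lambda>(n, V). cylinder X \<pi> n V) ` (SIGMA n:{1..}. B n). C \<subseteq> U}"
    have "U \<subseteq> \<Union>?C"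
    proof
      fix y assume "y \<in> U"
      then obtain n V where n: "1 \<le> n" "openin (X n) V" "y \<in> cylinder X \<pi> n V"
        "cylinder X \<pi> n V \<subseteq> U"
        by (rule openin_proj_lim_top_cylinder[OF U])
      then obtain W where W: "W \<in> B n" "y n \<in> W" "W \<subseteq> V"
        using B(3)[of n V "y n"] by (auto simp: cylinder_def)
      then have "cylinder X \<pi> n W \<subseteq> U" "y \<in> cylinder X \<pi> n W"
        using n by (auto simp: cylinder_def)
      then show "y \<in> \<Union>?C"
        using n(1) W(1) by force
    qed
    then have "U = \<Union>?C"
      by blast
    moreover have "countable ?C"
      using B(1) by (intro countable_Collect countable_image countable_SIGMA) auto
    moreover have "?C \<subseteq> borel_cylinders X \<pi>"
      using B(2) openin_imp_sets_borel_of_top by (fastforce simp: borel_cylinders_def)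
    ultimately show ?thesis
      using sigma_sets_UNION[of ?C] by (metis (no_types, lifting) sigma_sets.Basic subsetD)
  qed
  then show "sets (borel_of_top (proj_lim_top X \<pi>)) \<subseteq>
      sigma_sets (proj_lim_set X \<pi>) (borel_cylinders X \<pi>)"
    unfolding sets_borel_of_top topspace_proj_lim_top by (intro sigma_sets_mono) auto
  have "cylinder X \<pi> n A \<in> sets (borel_of_top (proj_lim_top X \<pi>))"
    if "1 \<le> n" "A \<in> sets (borel_of_top (X n))" for n A
    using measurable_sets[OF continuous_map_imp_measurable[OF continuous_map_coord[OF that(1), of X \<pi>]] that(2)]
    by (simp add: cylinder_def vimage_def Int_def conj_commute topspace_proj_lim_top)
  then have "borel_cylinders X \<pi> \<subseteq> sets (borel_of_top (proj_lim_top X \<pi>))"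
    by (auto simp: borel_cylinders_def)
  then show "sigma_sets (proj_lim_set X \<pi>) (borel_cylinders X \<pi>) \<subseteq>
      sets (borel_of_top (proj_lim_top X \<pi>))"
    by (metis sets.sigma_sets_subset space_borel_of_top topspace_proj_lim_top)
qed

end

section \<open>The limit action\<close>

text \<open>
  Compatibility makes the choice of the representative \<open>(n, g)\<close> immaterial. Projecting from level
  \<open>max n k\<close> serves the coordinates \<open>k < n\<close>, on which \<open>g\<close> has no direct action.
\<close>

definition limit_action ::
    "(nat \<Rightarrow> 'a topology) \<Rightarrow> (nat \<Rightarrow> nat \<Rightarrow> 'a \<Rightarrow> 'a) \<Rightarrow> (nat \<Rightarrow> nat \<Rightarrow> 'g \<Rightarrow> 'g) \<Rightarrow>
     (nat \<Rightarrow> 'g \<Rightarrow> 'a \<Rightarrow> 'a) \<Rightarrow> (nat \<times> 'g) set \<Rightarrow> (nat \<Rightarrow> 'a) \<Rightarrow> (nat \<Rightarrow> 'a)" where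
  "limit_action X \<pi> \<eta> act P =
     (\<lambda>y\<in>proj_lim_set X \<pi>. \<lambda>k\<in>{1..}.
        let (n, g) = (SOME p. p \<in> P); m = max n k in \<pi> m k (act m (\<eta> n m g) (y m)))"

locale compatible_action_systems =
  P: projective_system X \<pi> + D: direct_system G \<eta>
  for X :: "nat \<Rightarrow> 'a topology" and \<pi>
    and G :: "nat \<Rightarrow> ('g, 'b) monoid_scheme" and \<eta> +
  fixes act :: "nat \<Rightarrow> 'g \<Rightarrow> 'a \<Rightarrow> 'a"
  assumes polish: "\<And>n. 1 \<le> n \<Longrightarrow> polish_top (X n)"
    and action: "\<And>n. 1 \<le> n \<Longrightarrow> measurable_action (G n) (borel_of_top (X n)) (act n)"
    and compatible: "compatible_systems X \<pi> G \<eta> act"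
begin

lemma group_action: "1 \<le> n \<Longrightarrow> group_action (G n) (topspace (X n)) (act n)"
  using action[of n] by (simp add: measurable_action_def)

lemma act_closed:
  "\<lbrakk>1 \<le> n; g \<in> carrier (G n); x \<in> topspace (X n)\<rbrakk> \<Longrightarrow> act n g x \<in> topspace (X n)"
  using group_action.element_image[OF group_action] by blast

lemma proj_closed: "\<lbrakk>1 \<le> n; n \<le> m; x \<in> topspace (X m)\<rbrakk> \<Longrightarrow> \<pi> m n x \<in> topspace (X n)"
  using P.continuous[of n m] by (auto simp: continuous_map_def)

text \<open>Points are Borel sets, so the setwise compatibility condition can be tested on singletons.\<close>

lemma proj_equivariant:
  assumes "1 \<le> n" "n \<le> m" "g \<in> carrier (G n)" "x \<in> topspace (X m)"
  shows "\<pi> m n (act m (\<eta> n m g) x) = act n g (\<pi> m n x)"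
proof -
  have "closedin (X n) {\<pi> m n x}"
    using metrizable_imp_t1_space[OF polish_top_imp_metrizable[OF polish[OF assms(1)]]]
      proj_closed assms by (simp add: t1_space_closedin_singleton)
  then have "{\<pi> m n x} \<in> sets (borel_of_top (X n))"
    by (rule closedin_imp_sets_borel_of_top)
  then have "\<pi> m n -` (act n g ` {\<pi> m n x}) \<inter> topspace (X m) =
      act m (\<eta> n m g) ` (\<pi> m n -` {\<pi> m n x} \<inter> topspace (X m))"
    by (rule compatible[unfolded compatible_systems_def, rule_format, OF conjI, OF assms(1-3)])
  \<comment> \<open>The point \<open>x\<close> lies in the fibre over its own projection. Its image
    therefore belongs to the left-hand set, whose members all project to
    \<open>act n g (\<pi> m n x)\<close>.\<close>
  moreover have "act m (\<eta> n m g) x \<in> act m (\<eta> n m g) ` (\<pi> m n -` {\<pi> m n x} \<inter> topspace (X m))"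
    using assms(4) by (intro imageI) simp
  ultimately have "act m (\<eta> n m g) x \<in> \<pi> m n -` (act n g ` {\<pi> m n x}) \<inter> topspace (X m)"
    by (simp only:)
  then show ?thesis
    by simp
qed

text \<open>The projection from \<open>l\<close> to \<open>k\<close> factors through
  \<open>m\<close>, and equivariance of \<open>\<pi> l m\<close> turns the action of
  \<open>\<eta> n l g\<close> on \<open>y l\<close> into that of \<open>\<eta> n m g\<close> on
  \<open>y m\<close>.\<close>

lemma limit_action_coherent:
  assumes "1 \<le> n" "g \<in> carrier (G n)" "y \<in> proj_lim_set X \<pi>" "1 \<le> k" "max n k \<le> m" "m \<le> l"
  shows "\<pi> m k (act m (\<eta> n m g) (y m)) = \<pi> l k (act l (\<eta> n l g) (y l))"
proof -
  have "\<eta> n m g \<in> carrier (G m)" "y l \<in> topspace (X l)" "\<eta> n l g \<in> carrier (G l)"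
    "\<eta> n l g = \<eta> m l (\<eta> n m g)" "\<pi> l m (y l) = y m"
    using assms D.map_closed[of n m g] D.map_closed[of n l g] D.composition[of n m l g]
    by (auto simp: proj_lim_set_coord proj_lim_set_proj)
  then show ?thesis
    using proj_equivariant[of m l "\<eta> n m g" "y l"] P.composition[of k m l "act l (\<eta> n l g) (y l)"]
      act_closed[of l "\<eta> n l g" "y l"] assms by simp
qed

section \<open>The limit group acting on threads\<close>

abbreviation "L \<equiv> proj_lim_set X \<pi>"
abbreviation "limit_act \<equiv> limit_action X \<pi> \<eta> act"

text \<open>This removes the choice made by \<open>SOME\<close>: the formula for the chosen
  representative is raised to a level where it has merged with \<open>(n, g)\<close>, and then
  brought down to \<open>l\<close>.\<close>

lemma limit_act_coord:
  assumes n: "1 \<le> n" and g: "g \<in> carrier (G n)" and y: "y \<in> L" and k: "1 \<le> k" and l: "max n k \<le> l"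
  shows "limit_act (dir_lim_map G \<eta> n g) y k = \<pi> l k (act l (\<eta> n l g) (y l))"
proof -
  obtain m h where mh: "(SOME p. p \<in> dir_lim_map G \<eta> n g) = (m, h)"
    by fastforce
  have "(n, g) \<in> dir_lim_map G \<eta> n g"
    using n g by (auto simp: D.mem_dir_lim_map_iff)
  then have "(m, h) \<in> dir_lim_map G \<eta> n g"
    using someI[of "\<lambda>p. p \<in> dir_lim_map G \<eta> n g"] mh by auto
  then obtain i where m: "1 \<le> m" "h \<in> carrier (G m)"
    and i: "max n m \<le> i" "\<eta> n i g = \<eta> m i h"
    using D.mem_dir_lim_map_iff[OF n g, of m h] by blast
  \<comment> \<open>Above \<open>i\<close> the two representatives agree. Above \<open>l\<close> and
    \<open>max m k\<close> both formulas can be compared by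
    \<open>limit_action_coherent\<close>.\<close>
  define r where "r = max (max l i) (max m k)"
  have "limit_act (dir_lim_map G \<eta> n g) y k = \<pi> (max m k) k (act (max m k) (\<eta> m (max m k) h) (y (max m k)))"
    using y k by (simp add: limit_action_def mh Let_def)
  also have "\<dots> = \<pi> r k (act r (\<eta> m r h) (y r))"
    using m y k by (intro limit_action_coherent) (auto simp: r_def)
  also have "\<eta> m r h = \<eta> n r g"
    using D.eq_later[OF n m(1) g m(2) i, of r] by (simp add: r_def)
  also have "\<pi> r k (act r (\<eta> n r g) (y r)) = \<pi> l k (act l (\<eta> n l g) (y l))"
    using n g y k l by (intro limit_action_coherent[symmetric]) (auto simp: r_def)
  finally show ?thesis .
qed

text \<open>From level \<open>n\<close> on the evaluation level can be \<open>k\<close> itself, so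
  the projection becomes the identity. Together with \<open>proj_lim_set_eqI\<close> this reduces
  the action laws to those of the \<open>act k\<close>.\<close>

lemma limit_act_coord_late:
  assumes "1 \<le> n" "g \<in> carrier (G n)" "y \<in> L" "n \<le> k"
  shows "limit_act (dir_lim_map G \<eta> n g) y k = act k (\<eta> n k g) (y k)"
proof -
  have "act k (\<eta> n k g) (y k) \<in> topspace (X k)"
    using act_closed[of k "\<eta> n k g" "y k"] D.map_closed[of n k g] proj_lim_set_coord[of y X \<pi> k] assms
    by simp
  then show ?thesis
    using limit_act_coord[OF assms(1-3), of k k] assms P.identity[of k] by simp
qed

lemma limit_act_coord_level:
  assumes "1 \<le> n" "g \<in> carrier (G n)" "y \<in> L"
  shows "limit_act (dir_lim_map G \<eta> n g) y n = act n g (y n)"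
  using limit_act_coord_late[OF assms, of n] D.identity assms by simp

text \<open>Coordinates \<open>k\<close> and \<open>m\<close> of the image can both be evaluated at
  level \<open>max n m\<close>; the thread condition is then the composition law of the
  projections.\<close>

lemma limit_act_closed:
  assumes n: "1 \<le> n" and g: "g \<in> carrier (G n)" and y: "y \<in> L"
  shows "limit_act (dir_lim_map G \<eta> n g) y \<in> L"
proof -
  let ?z = "limit_act (dir_lim_map G \<eta> n g) y"
  have late: "act l (\<eta> n l g) (y l) \<in> topspace (X l)" if "n \<le> l" for l
    using act_closed[of l "\<eta> n l g" "y l"] D.map_closed[of n l g] proj_lim_set_coord[OF y, of l] n g that
    by simp
  have z: "?z k = \<pi> l k (act l (\<eta> n l g) (y l))" if "1 \<le> k" "max n k \<le> l" for k l
    using limit_act_coord[OF n g y that] .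
  have "?z \<in> (\<Pi>\<^sub>E k\<in>{1..}. topspace (X k))"
  proof (rule PiE_I)
    fix k :: nat assume "k \<in> {1..}"
    then show "?z k \<in> topspace (X k)"
      using z[of k "max n k"] late[of "max n k"] by (auto intro!: proj_closed)
  next
    fix k :: nat assume "k \<notin> {1..}"
    then show "?z k = undefined"
      using y by (simp add: limit_action_def)
  qed
  moreover have "?z k = \<pi> m k (?z m)" if "1 \<le> k" "k \<le> m" for k m
    using z[of k "max n m"] z[of m "max n m"] that P.composition[of k m "max n m"] late[of "max n m"]
    by simp
  ultimately show ?thesis
    unfolding proj_lim_set_def by blast
qed

lemma limit_group_action: "group_action (dir_lim G \<eta>) L limit_act"
proof (rule group_actionI[OF D.group_dir_lim])
  show "limit_act P y \<in> L" if P: "P \<in> carrier (dir_lim G \<eta>)" and y: "y \<in> L" for P y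
    by (rule D.dir_lim_carrier2E[OF P P]) (use limit_act_closed y in simp)
  show "limit_act P \<in> extensional L" for P
    by (simp add: limit_action_def)
  show "limit_act \<one>\<^bsub>dir_lim G \<eta>\<^esub> y = y" if y: "y \<in> L" for y
  proof (rule proj_lim_set_eqI[OF _ y])
    \<comment> \<open>With the unit represented at level 1, every coordinate from 1 on is late, so
      the formula without projection applies to all of them.\<close>
    have one: "\<one>\<^bsub>dir_lim G \<eta>\<^esub> = dir_lim_map G \<eta> 1 \<one>\<^bsub>G 1\<^esub>" "\<one>\<^bsub>G 1\<^esub> \<in> carrier (G 1)"
      using D.dir_lim_one[of 1] D.groups[of 1] by (simp_all add: group.is_monoid)
    show "limit_act \<one>\<^bsub>dir_lim G \<eta>\<^esub> y \<in> L"
      using limit_act_closed y one by simp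
    fix k :: nat assume k: "1 \<le> k"
    have "limit_act \<one>\<^bsub>dir_lim G \<eta>\<^esub> y k = act k \<one>\<^bsub>G k\<^esub> (y k)"
      using limit_act_coord_late[of 1 _ y k] one y k D.map_one[of 1 k] by simp
    also have "\<dots> = y k"
      using group_action.id_eq_one[OF group_action[OF k]] proj_lim_set_coord[OF y k]
      by (metis restrict_apply')
    finally show "limit_act \<one>\<^bsub>dir_lim G \<eta>\<^esub> y k = y k" .
  qed
  show "limit_act (P \<otimes>\<^bsub>dir_lim G \<eta>\<^esub> Q) y = limit_act P (limit_act Q y)"
    if PQ: "P \<in> carrier (dir_lim G \<eta>)" "Q \<in> carrier (dir_lim G \<eta>)" and y: "y \<in> L" for P Q y
  proof -
    obtain n g h where n: "1 \<le> n" and g: "g \<in> carrier (G n)" and h: "h \<in> carrier (G n)"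
      and P: "P = dir_lim_map G \<eta> n g" and Q: "Q = dir_lim_map G \<eta> n h"
      by (rule D.dir_lim_carrier2E[OF PQ])
    have gh: "g \<otimes>\<^bsub>G n\<^esub> h \<in> carrier (G n)"
      using D.groups[OF n] g h by (simp add: group.subgroup_self subgroup.m_closed)
    have mult: "P \<otimes>\<^bsub>dir_lim G \<eta>\<^esub> Q = dir_lim_map G \<eta> n (g \<otimes>\<^bsub>G n\<^esub> h)"
      using D.dir_lim_mult n g h P Q by simp
    have Qy: "limit_act Q y \<in> L"
      using limit_act_closed n h y Q by simp
    show ?thesis
    \<comment> \<open>On coordinates \<open>k\<close> from \<open>n\<close> on, both sides act
      directly, and the law is the one for \<open>G k\<close> acting on \<open>X k\<close>.\<close>
    proof (rule proj_lim_set_eqI)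
      show "limit_act (P \<otimes>\<^bsub>dir_lim G \<eta>\<^esub> Q) y \<in> L"
        using limit_act_closed n gh y mult by simp
      show "limit_act P (limit_act Q y) \<in> L"
        using limit_act_closed n g Qy P by simp
      fix k assume k: "n \<le> k"
      show "limit_act (P \<otimes>\<^bsub>dir_lim G \<eta>\<^esub> Q) y k = limit_act P (limit_act Q y) k"
        using limit_act_coord_late[OF n gh y k] limit_act_coord_late[OF n g Qy k]
          limit_act_coord_late[OF n h y k] mult P Q n g h k D.map_mult[of n k g h]
          D.map_closed[of n k] proj_lim_set_coord[OF y, of k]
          group_action.composition_rule[OF group_action, of k "y k" "\<eta> n k g" "\<eta> n k h"]
        by simp
    qed
  qed
qed

section \<open>Measurability of the limit action and invariance of the limit measure\<close>

lemma sets_borel_limit: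
  "sets (borel_of_top (proj_lim_top X \<pi>)) = sigma_sets L (borel_cylinders X \<pi>)"
  by (intro P.sets_borel_proj_lim_top polish_top_imp_second_countable polish)

lemma limit_act_vimage_cylinder:
  assumes n: "1 \<le> n" and g: "g \<in> carrier (G n)" and k: "n \<le> k"
  shows "limit_act (dir_lim_map G \<eta> n g) -` cylinder X \<pi> k A \<inter> L =
    cylinder X \<pi> k (act k (\<eta> n k g) -` A \<inter> topspace (X k))"
proof -
  have "1 \<le> k" using n k by simp
  then have "limit_act (dir_lim_map G \<eta> n g) y \<in> cylinder X \<pi> k A \<longleftrightarrow>
      act k (\<eta> n k g) (y k) \<in> A \<and> y k \<in> topspace (X k)" if "y \<in> L" for y
    using limit_act_closed[OF n g that] limit_act_coord_late[OF n g that k]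
      proj_lim_set_coord[OF that, of k] by (simp add: cylinder_def)
  then show ?thesis
    by (auto simp: cylinder_def[of X \<pi> k "act k (\<eta> n k g) -` A \<inter> topspace (X k)"])
qed

lemma act_measurable:
  "\<lbrakk>1 \<le> n; g \<in> carrier (G n)\<rbrakk> \<Longrightarrow> act n g \<in> measurable (borel_of_top (X n)) (borel_of_top (X n))"
  by (rule measurable_action_imp_measurable[OF action])

text \<open>The class and the cylinder each have a threshold; at the larger one the representative
  acts directly on the coordinate that defines the cylinder. Measurability of \<open>act k g\<close>
  keeps the new base Borel.\<close>

lemma limit_act_vimage_borel_cylinder:
  assumes "P \<in> carrier (dir_lim G \<eta>)" "C \<in> borel_cylinders X \<pi>"
  obtains k g A where "1 \<le> k" "g \<in> carrier (G k)" "A \<in> sets (borel_of_top (X k))"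
    "C = cylinder X \<pi> k A"
    "limit_act P -` C \<inter> L = cylinder X \<pi> k (act k g -` A \<inter> topspace (X k))"
    "act k g -` A \<inter> topspace (X k) \<in> sets (borel_of_top (X k))"
proof -
  obtain n where n: "1 \<le> n" "\<And>k. n \<le> k \<Longrightarrow> \<exists>g\<in>carrier (G k). P = dir_lim_map G \<eta> k g"
    using D.dir_lim_carrier_levels[OF assms(1)] by blast
  obtain m where m: "1 \<le> m"
    "\<And>k. m \<le> k \<Longrightarrow> \<exists>A\<in>sets (borel_of_top (X k)). C = cylinder X \<pi> k A"
    using P.borel_cylinders_level[OF assms(2)] by blast
  define k where "k = max n m"
  have k: "1 \<le> k" "n \<le> k" "m \<le> k"
    using n by (auto simp: k_def)
  obtain g A where g: "g \<in> carrier (G k)" "P = dir_lim_map G \<eta> k g"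
    and A: "A \<in> sets (borel_of_top (X k))" "C = cylinder X \<pi> k A"
    using n(2)[OF k(2)] m(2)[OF k(3)] by blast
  show ?thesis
    using that[OF k(1) g(1) A] limit_act_vimage_cylinder[OF k(1) g(1) order_refl, of A]
      D.identity[OF k(1) g(1)] measurable_sets[OF act_measurable[OF k(1) g(1)] A(1)] g A
    by simp
qed

lemma limit_act_measurable:
  assumes P: "P \<in> carrier (dir_lim G \<eta>)"
  shows "limit_act P \<in> measurable (borel_of_top (proj_lim_top X \<pi>)) (borel_of_top (proj_lim_top X \<pi>))"
proof (rule measurable_sigma_sets[OF sets_borel_limit borel_cylinders_subset])
  show "limit_act P \<in> space (borel_of_top (proj_lim_top X \<pi>)) \<rightarrow> L"
    using group_action.element_image[OF limit_group_action P] by (auto simp: topspace_proj_lim_top)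
  fix C assume "C \<in> borel_cylinders X \<pi>"
  then show "limit_act P -` C \<inter> space (borel_of_top (proj_lim_top X \<pi>))
      \<in> sets (borel_of_top (proj_lim_top X \<pi>))"
    unfolding sets_borel_limit space_borel_of_top topspace_proj_lim_top
    by (elim limit_act_vimage_borel_cylinder[OF P])
      (auto simp: borel_cylinders_def intro!: sigma_sets.Basic)
qed

lemma limit_measurable_action:
  "measurable_action (dir_lim G \<eta>) (borel_of_top (proj_lim_top X \<pi>)) limit_act"
  using limit_group_action limit_act_measurable
  by (intro measurable_actionI) (simp_all add: topspace_proj_lim_top)

text \<open>Invariance amounts to \<nu> being its own push-forward under each
  \<open>limit_act P\<close>. Uniqueness of finite measures on an intersection-stable generator
  leaves only cylinders, whose \<nu>-measures are given by the marginals.\<close>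

lemma limit_measure_invariant:
  assumes inv: "\<And>n. 1 \<le> n \<Longrightarrow> invariant_measure (G n) (act n) (\<mu> n)"
    and lim: "is_proj_lim_measure X \<pi> \<mu> \<nu>"
  shows "invariant_measure (dir_lim G \<eta>) limit_act \<nu>"
proof -
  have sets: "sets \<nu> = sets (borel_of_top (proj_lim_top X \<pi>))" and prob: "prob_space \<nu>"
    and marginal: "\<And>n. 1 \<le> n \<Longrightarrow> \<mu> n = distr \<nu> (borel_of_top (X n)) (\<lambda>y. y n)"
    using lim by (auto simp: is_proj_lim_measure_def prob_measure_on_def)
  interpret prob_space \<nu> by (rule prob)
  have space: "space \<nu> = L"
    using sets_eq_imp_space_eq[OF sets] by (simp add: topspace_proj_lim_top)
  have coord: "(\<lambda>y. y n) \<in> measurable \<nu> (borel_of_top (X n))" if "1 \<le> n" for n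
    using continuous_map_imp_measurable[OF continuous_map_coord[OF that]]
      measurable_cong_sets[OF sets refl] by blast
  have cyl: "emeasure \<nu> (cylinder X \<pi> n A) = emeasure (\<mu> n) A"
    if "1 \<le> n" "A \<in> sets (borel_of_top (X n))" for n A
    using emeasure_distr[OF coord[OF that(1)] that(2)] marginal[OF that(1)]
    by (simp add: cylinder_def vimage_def Int_def conj_commute space)
  have "distr \<nu> \<nu> (limit_act P) = \<nu>" if P: "P \<in> carrier (dir_lim G \<eta>)" for P
  proof -
    have meas: "limit_act P \<in> measurable \<nu> \<nu>"
      using limit_act_measurable[OF P] measurable_cong_sets[OF sets sets] by blast
    show ?thesis
    proof (rule measure_eqI_generator_eq[OF P.Int_stable_borel_cylinders borel_cylinders_subset])
      show "sets (distr \<nu> \<nu> (limit_act P)) = sigma_sets L (borel_cylinders X \<pi>)"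
        "sets \<nu> = sigma_sets L (borel_cylinders X \<pi>)"
        by (simp_all add: sets sets_borel_limit)
      \<comment> \<open>The uniqueness theorem needs an exhaustion by generator sets of finite
        measure. The whole space is itself a cylinder, so a constant sequence suffices.\<close>
      have "L = cylinder X \<pi> 1 (topspace (X 1))"
        by (auto simp: cylinder_def proj_lim_set_coord)
      then have "L \<in> borel_cylinders X \<pi>"
        using openin_imp_sets_borel_of_top[OF openin_topspace]
        by (auto simp: borel_cylinders_def)
      then show "range (\<lambda>_::nat. L) \<subseteq> borel_cylinders X \<pi>"
        by auto
      show "(\<Union>i::nat. L) = L"
        by simp
      show "emeasure (distr \<nu> \<nu> (limit_act P)) L \<noteq> \<infinity>"
        using finite_measure.emeasure_finite[OF prob_space.finite_measure[OF prob_space_distr[OF meas]]]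
        by simp
      fix C assume C: "C \<in> borel_cylinders X \<pi>"
      obtain k g A where k: "1 \<le> k" and g: "g \<in> carrier (G k)"
        and A: "A \<in> sets (borel_of_top (X k))" "C = cylinder X \<pi> k A"
          "limit_act P -` C \<inter> L = cylinder X \<pi> k (act k g -` A \<inter> topspace (X k))"
          "act k g -` A \<inter> topspace (X k) \<in> sets (borel_of_top (X k))"
        by (rule limit_act_vimage_borel_cylinder[OF P C])
      have sets_\<mu>: "sets (\<mu> k) = sets (borel_of_top (X k))" "space (\<mu> k) = topspace (X k)"
        using marginal[OF k] by simp_all
      have "C \<in> sets \<nu>"
        using C by (simp add: sets sets_borel_limit)
      then have "emeasure (distr \<nu> \<nu> (limit_act P)) C = emeasure \<nu> (limit_act P -` C \<inter> L)"
        using meas by (simp add: emeasure_distr space)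
      also have "\<dots> = emeasure (\<mu> k) (act k g -` A \<inter> topspace (X k))"
        using A k by (simp add: cyl)
      also have "\<dots> = emeasure (\<mu> k) A"
        using inv[OF k] group_action.invariant_measure_iff[OF group_action[OF k] sets_\<mu>(2)]
          g A(1) sets_\<mu>(1) by simp
      also have "\<dots> = emeasure \<nu> C"
        using A k by (simp add: cyl)
      finally show "emeasure (distr \<nu> \<nu> (limit_act P)) C = emeasure \<nu> C" .
    qed
  qed
  moreover have "emeasure (distr \<nu> \<nu> (limit_act P)) A = emeasure \<nu> (limit_act P -` A \<inter> L)"
    if "P \<in> carrier (dir_lim G \<eta>)" "A \<in> sets \<nu>" for P A
    using emeasure_distr[of "limit_act P" \<nu> \<nu> A] limit_act_measurable[OF that(1)]
      measurable_cong_sets[OF sets sets] that(2) space by auto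
  ultimately show ?thesis
    using group_action.invariant_measure_iff[OF limit_group_action space] by simp
qed

end

theorem theorem3p1:
  fixes X :: "nat \<Rightarrow> 'a topology"
    and \<pi> :: "nat \<Rightarrow> nat \<Rightarrow> 'a \<Rightarrow> 'a"
    and G :: "nat \<Rightarrow> ('g, 'b) monoid_scheme"
    and \<eta> :: "nat \<Rightarrow> nat \<Rightarrow> 'g \<Rightarrow> 'g"
    and act :: "nat \<Rightarrow> 'g \<Rightarrow> 'a \<Rightarrow> 'a"
  assumes "projective_system X \<pi>"
    and "\<And>n. 1 \<le> n \<Longrightarrow> polish_top (X n)"
    and "direct_system G \<eta>"
    and "\<And>n. 1 \<le> n \<Longrightarrow> measurable_action (G n) (borel_of_top (X n)) (act n)"
    and "compatible_systems X \<pi> G \<eta> act"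
  shows "\<exists>actN :: (nat \<times> 'g) set \<Rightarrow> (nat \<Rightarrow> 'a) \<Rightarrow> (nat \<Rightarrow> 'a).
      measurable_action (dir_lim G \<eta>) (borel_of_top (proj_lim_top X \<pi>)) actN \<and>
      (\<forall>n\<ge>1. \<forall>g\<in>carrier (G n). \<forall>x\<in>topspace (proj_lim_top X \<pi>).
         (actN (dir_lim_map G \<eta> n g) x) n = act n g (x n)) \<and>
      (\<forall>\<mu> \<nu>. projective_measures X \<pi> \<mu> \<and>
         (\<forall>n\<ge>1. invariant_measure (G n) (act n) (\<mu> n)) \<and>
         is_proj_lim_measure X \<pi> \<mu> \<nu> \<longrightarrow>
         invariant_measure (dir_lim G \<eta>) actN \<nu>)"
proof -
  interpret compatible_action_systems X \<pi> G \<eta> act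
    by (intro compatible_action_systems.intro compatible_action_systems_axioms.intro) fact+
  show ?thesis
  proof (intro exI[of _ "limit_action X \<pi> \<eta> act"] conjI allI ballI impI)
    show "measurable_action (dir_lim G \<eta>) (borel_of_top (proj_lim_top X \<pi>)) limit_act"
      by (rule limit_measurable_action)
    show "limit_act (dir_lim_map G \<eta> n g) x n = act n g (x n)"
      if "1 \<le> n" "g \<in> carrier (G n)" "x \<in> topspace (proj_lim_top X \<pi>)" for n g x
      using limit_act_coord_level that by (simp add: topspace_proj_lim_top)
    show "invariant_measure (dir_lim G \<eta>) limit_act \<nu>"
      if "projective_measures X \<pi> \<mu> \<and>
        (\<forall>n\<ge>1. invariant_measure (G n) (act n) (\<mu> n)) \<and> is_proj_lim_measure X \<pi> \<mu> \<nu>" for \<mu> \<nu>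
      using that by (intro limit_measure_invariant[of \<mu>]) auto
  qed
qed

end
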